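(* Let $n \geq 1$ be an integer, let $T_i=\binom{i+1}{2}$, and let $(\rho_n,\lambda_n)$ be the unique pair of integers with $\rho_n \geq 1$, $0 \leq \lambda_n \leq \rho_n+1$ and $n = T_{\rho_n+1}-2+\lambda_n$. For every maximum weight jump-float sequence $s \in \mathcal{M}^*_n$, its extended block sequence $\overline{b}$ has one of the following forms: A. $\overline{b} = (\overline{b}_1, \overline{b}_2, \ldots, \overline{b}_{\rho_n})$ where $$\overline{b}_j = \begin{cases} j & \text{for } j \notin X,\\ j+1 & \text{for } j \in X,\end{cases} \qquad\text{for some } X \in \binom{[\rho_n]}{\lambda_n};$$ B. $\overline{b} = (\overline{b}_1, \overline{b}_2, \ldots, \overline{b}_{\rho_n+1})$ where $$\overline{b}_j = \begin{cases} j & \text{for } j \in X,\\ j-1 & \text{for } j \notin X,\end{cases} \qquad\text{for some } X \in \binom{[\rho_n+1]}{\lambda_n-1}.$$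
   Context: A jump-float sequence of length $n$ is an integer sequence $s=(s_1,\ldots,s_n)$ with $0\le s_i\le i$ for $1\le i\le n$ and such that, for $2\le i\le n$, if $s_i>s_{i-1}$ then $s_{i-1}=0$. Its weight is $w(s)=\sum_{i=1}^n s_i$. $\mathcal{M}^*_n$ is the set of jump-float sequences of length $n$ of maximum weight among all jump-float sequences of length $n$ (each of these is also maximal in the componentwise order). A block of $s\in\mathcal{M}^*_n$ is a maximal run of consecutive nonzero entries of $s$; its width is the length of the run. The block sequence $b=(b_1,\ldots,b_k)$ of $s$ is the list of widths of the blocks of $s$, from left to right. The extended block sequence $\overline{b}$ of $s$ is $\overline{b}=b$ if $s_1=1$, and $\overline{b}=(0,b_1,b_2,\ldots,b_k)$ if $s_1=0$. $\binom{[m]}{r}$ denotes the set of $r$-element subsets of $[m]=\{1,\ldots,m\}$, which is empty if $r<0$ or $r>m$. *)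

theory Defs
  imports Main
begin

text \<open>A sequence $(s_1,\ldots,s_n)$ is a list of length $n$; \<open>entry\<close> uses the indices $1,\ldots,n$.\<close>

definition entry :: "int list \<Rightarrow> nat \<Rightarrow> int"
  where "entry s i = s ! (i - 1)"

definition jump_float :: "nat \<Rightarrow> int list \<Rightarrow> bool"
  where "jump_float n s \<longleftrightarrow>
    length s = n \<and>
    (\<forall>i\<in>{1..n}. 0 \<le> entry s i \<and> entry s i \<le> int i) \<and>
    (\<forall>i\<in>{2..n}. entry s i > entry s (i - 1) \<longrightarrow> entry s (i - 1) = 0)"

definition weight :: "int list \<Rightarrow> int"
  where "weight s = (\<Sum>i=1..length s. entry s i)"

definition max_jump_floats :: "nat \<Rightarrow> int list set"
  where "max_jump_floats n =
    {s. jump_float n s \<and> (\<forall>t. jump_float n t \<longrightarrow> weight t \<le> weight s)}"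

definition is_block :: "int list \<Rightarrow> nat \<Rightarrow> nat \<Rightarrow> bool"
  where "is_block s i j \<longleftrightarrow>
    1 \<le> i \<and> i \<le> j \<and> j \<le> length s \<and>
    (\<forall>k\<in>{i..j}. entry s k \<noteq> 0) \<and>
    (i = 1 \<or> entry s (i - 1) = 0) \<and>
    (j = length s \<or> entry s (j + 1) = 0)"

text \<open>A block is determined by its first position, so listing the pairs \<open>(i, j)\<close>
  in lexicographic order lists the blocks from left to right.\<close>

definition block_seq :: "int list \<Rightarrow> nat list"
  where "block_seq s =
    [j - i + 1. i \<leftarrow> [1..<length s + 1], j \<leftarrow> [1..<length s + 1], is_block s i j]"

text \<open>For a nonempty jump-float sequence the first entry is 0 or 1.\<close>

definition ext_block_seq :: "int list \<Rightarrow> nat list"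
  where "ext_block_seq s = (if entry s 1 = 0 then 0 # block_seq s else block_seq s)"

definition tri :: "nat \<Rightarrow> nat"
  where "tri i = (i + 1) choose 2"

text \<open>The size \<open>r\<close> is an integer: there are no subsets of negative size.\<close>

definition subsets_of_size :: "nat \<Rightarrow> int \<Rightarrow> nat set set"
  where "subsets_of_size m r = {X. X \<subseteq> {1..m} \<and> int (card X) = r}"

lemma tri_Suc: "tri (Suc i) = tri i + Suc i"
  by (simp add: tri_def numeral_2_eq_2)

lemma tri_mono: "i \<le> j \<Longrightarrow> tri i \<le> tri j"
  by (induction j) (auto simp: tri_Suc le_Suc_eq)

lemma tri_decomposition_ex1:
  assumes "n \<ge> 1"
  shows "\<exists>!(\<rho>, l). \<rho> \<ge> 1 \<and> l \<le> \<rho> + 1 \<and> int n = int (tri (\<rho> + 1)) - 2 + int l"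
proof -
  have "\<exists>\<rho> l. \<rho> \<ge> 1 \<and> l \<le> \<rho> + 1 \<and> int n = int (tri (\<rho> + 1)) - 2 + int l"
    using assms
  proof (induction n rule: nat_induct_at_least)
    case base
    have "tri 2 = 3" by (simp add: tri_def numeral_2_eq_2)
    then show ?case by (intro exI[of _ 1] exI[of _ 0]) (simp add: numeral_2_eq_2)
  next
    case (Suc n)
    then obtain \<rho> l where *: "\<rho> \<ge> 1" "l \<le> \<rho> + 1" "int n = int (tri (\<rho> + 1)) - 2 + int l"
      by blast
    show ?case
    proof (cases "l = \<rho> + 1")
      case True
      then show ?thesis using * by (intro exI[of _ "\<rho> + 1"] exI[of _ 0]) (simp add: tri_Suc)
    next
      case False
      then show ?thesis using * by (intro exI[of _ \<rho>] exI[of _ "l + 1"]) simp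
    qed
  qed
  moreover have "\<not> \<rho> < \<rho>'"
    if "l \<le> \<rho> + 1" "int n = int (tri (\<rho> + 1)) - 2 + int l"
       "int n = int (tri (\<rho>' + 1)) - 2 + int l'" for \<rho> l \<rho>' l'
    using that tri_mono[of "\<rho> + 2" "\<rho>' + 1"] by (auto simp: tri_Suc)
  ultimately show ?thesis
    by (auto simp: Ex1_def) (metis add_left_cancel linorder_neqE_nat of_nat_eq_iff)+
qed

end

theory Submission
  imports Defs
begin

text \<open>
  A jump-float sequence \<open>s\<close> is cut at its zeros into runs of widths \<open>a\<^sub>1, \<dots>, a\<^sub>k\<close> (zero widths
  allowed). Since a run starting at position \<open>p\<close> has entries at most \<open>p\<close>, the weight is at most
  \<open>V(a) = \<Sum>\<^sub>j p\<^sub>j a\<^sub>j\<close>, where \<open>p\<^sub>j\<close> is the starting position of run \<open>j\<close>, with equality only if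
  every run is constantly \<open>p\<^sub>j\<close>. So a maximum weight sequence amounts to a width list
  maximizing \<open>V\<close> under \<open>\<Sum>\<^sub>j (a\<^sub>j + 1) = n + 1\<close>. Removing one cell from run \<open>i\<close> and prepending an
  empty run changes \<open>V\<close> by \<open>a\<^sub>i - i - 1\<close>. This move, its inverse and compositions of the two show
  that at a maximum all \<open>a\<^sub>i - i\<close> lie in \<open>{0, 1}\<close> or all lie in \<open>{-1, 0}\<close>; counting cells gives
  the forms A and B.
\<close>

section \<open>Runs, width lists and layouts\<close>

fun layout_weight :: "nat \<Rightarrow> nat list \<Rightarrow> int" where
  "layout_weight p [] = 0"
| "layout_weight p (w # ws) = int p * int w + layout_weight (p + w + 1) ws"

text \<open>\<open>layout q ws\<close> starts with a zero at position \<open>q\<close>; in particular \<open>layout 0 ws\<close> has a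
  fictitious zero at position 0 in front of the actual sequence.\<close>

fun layout :: "nat \<Rightarrow> nat list \<Rightarrow> int list" where
  "layout q [] = []"
| "layout q (w # ws) = 0 # replicate w (int q + 1) @ layout (q + w + 1) ws"

text \<open>There is always one run more than there are zeros, so the empty list has a single empty
  run.\<close>

fun widths :: "int list \<Rightarrow> nat list" where
  "widths [] = [0]"
| "widths (x # xs) =
     (if x = 0 then 0 # widths xs else Suc (hd (widths xs)) # tl (widths xs))"

text \<open>\<open>jump_float_from q v s\<close>: \<open>s\<close> can be placed from position \<open>q\<close> on, when \<open>v\<close> is the bound that
  the preceding entries impose on its first entry.\<close>

fun jump_float_from :: "nat \<Rightarrow> int \<Rightarrow> int list \<Rightarrow> bool" where
  "jump_float_from q v [] \<longleftrightarrow> True"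
| "jump_float_from q v (x # xs) \<longleftrightarrow>
     0 \<le> x \<and> x \<le> v \<and> jump_float_from (Suc q) (if x = 0 then int (Suc q) else x) xs"

lemma widths_neq_Nil [simp]: "widths s \<noteq> []"
  by (cases s) auto

lemma sum_list_Suc_widths: "sum_list (map Suc (widths s)) = Suc (length s)"
proof (induction s)
  case (Cons x xs)
  then show ?case by (cases "widths xs") auto
qed simp

lemma length_layout: "length (layout q ws) = sum_list (map Suc ws)"
  by (induction q ws rule: layout.induct) auto

lemma sum_list_layout: "sum_list (layout q ws) = layout_weight (Suc q) ws"
  by (induction q ws rule: layout.induct) (auto simp: sum_list_replicate algebra_simps)

lemma layout_eq_Cons: "ws \<noteq> [] \<Longrightarrow> layout q ws = 0 # tl (layout q ws)"
  by (cases ws) auto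

lemma jump_float_from_replicate:
  assumes "v > 0"
  shows "jump_float_from q v (replicate w v @ s) \<longleftrightarrow> jump_float_from (q + w) v s"
  using assms by (induction w arbitrary: q) auto

lemma jump_float_from_layout:
  "v \<ge> 0 \<Longrightarrow> jump_float_from q v (layout q ws)"
  by (induction q ws arbitrary: v rule: layout.induct)
    (auto simp: jump_float_from_replicate add.commute)

text \<open>Entries never increase within a run, and the zero in front of a run caps its first entry
  by the next position. So each entry is at most the initial bound of its run (\<open>v\<close> for
  the first one), and equality of the sums makes all these bounds tight.\<close>

lemma sum_list_le_layout_weight:
  assumes "jump_float_from q v s" "widths s = w # ws"
  shows "sum_list s \<le> v * int w + layout_weight (q + w + 1) ws"
    and "sum_list s = v * int w + layout_weight (q + w + 1) ws \<Longrightarrow>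
         s = replicate w v @ layout (q + w) ws"
proof -
  have "sum_list s \<le> v * int w + layout_weight (q + w + 1) ws \<and>
    (sum_list s = v * int w + layout_weight (q + w + 1) ws \<longrightarrow>
         s = replicate w v @ layout (q + w) ws)"
    using assms
  proof (induction s arbitrary: q v w ws)
    case Nil
    then show ?case by auto
  next
    case (Cons x xs)
    obtain u us where u: "widths xs = u # us"
      by (cases "widths xs") auto
    show ?case
    proof (cases "x = 0")
      case True
      then have w: "w = 0" "ws = u # us"
        using Cons.prems u by auto
      show ?thesis
        using Cons.IH[OF _ u, of "Suc q" "int (Suc q)"] Cons.prems True
        unfolding w by (auto simp: algebra_simps)
    next
      case False
      have w: "w = Suc u" "ws = us" and x: "0 < x" "x \<le> v"
        using Cons.prems u False by auto
      have IH: "sum_list xs \<le> x * int u + layout_weight (Suc q + u + 1) us"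
        "sum_list xs = x * int u + layout_weight (Suc q + u + 1) us \<Longrightarrow>
         xs = replicate u x @ layout (Suc q + u) us"
        using Cons.IH[OF _ u, of "Suc q" x] Cons.prems False by auto
      \<comment> \<open>The rest of the run is bounded by \<open>x\<close>, so \<open>x < v\<close>
        would already lose weight at the first entry; equality forces \<open>x = v\<close>.\<close>
      have le: "x * int u \<le> v * int u"
        using x by (simp add: mult_right_mono)
      show ?thesis
      proof (intro conjI impI)
        show "sum_list (x # xs) \<le> v * int w + layout_weight (q + w + 1) ws"
          using IH(1) le x w by (simp add: algebra_simps)
        assume "sum_list (x # xs) = v * int w + layout_weight (q + w + 1) ws"
        then have "x = v" "sum_list xs = x * int u + layout_weight (Suc q + u + 1) us"
          using IH(1) le x w by (simp_all add: algebra_simps)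
        then show "x # xs = replicate w v @ layout (q + w) ws"
          using IH(2) w by simp
      qed
    qed
  qed
  then show "sum_list s \<le> v * int w + layout_weight (q + w + 1) ws"
    and "sum_list s = v * int w + layout_weight (q + w + 1) ws \<Longrightarrow>
         s = replicate w v @ layout (q + w) ws"
    by auto
qed

section \<open>Recursive and positionwise forms of the jump-float condition\<close>

lemma jump_float_from_iff:
  "jump_float_from q v s \<longleftrightarrow>
     (s \<noteq> [] \<longrightarrow> s ! 0 \<le> v) \<and> (\<forall>i<length s. 0 \<le> s ! i) \<and>
     (\<forall>i. Suc i < length s \<longrightarrow> s ! Suc i \<le> (if s ! i = 0 then int (q + Suc i) else s ! i))"
proof (induction q v s rule: jump_float_from.induct)
  case (2 q v x xs)
  have all_nat: "(\<forall>i. Q i) \<longleftrightarrow> Q 0 \<and> (\<forall>i. Q (Suc i))" for Q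
    by (metis not0_implies_Suc)
  have nonneg: "(\<forall>i<length (x # xs). 0 \<le> (x # xs) ! i) \<longleftrightarrow>
      0 \<le> x \<and> (\<forall>i<length xs. 0 \<le> xs ! i)"
    by (subst all_nat) simp
  have step: "(\<forall>i. Suc i < length (x # xs) \<longrightarrow>
        (x # xs) ! Suc i \<le> (if (x # xs) ! i = 0 then int (q + Suc i) else (x # xs) ! i)) \<longleftrightarrow>
      (xs \<noteq> [] \<longrightarrow> xs ! 0 \<le> (if x = 0 then int (Suc q) else x)) \<and>
      (\<forall>i. Suc i < length xs \<longrightarrow>
        xs ! Suc i \<le> (if xs ! i = 0 then int (Suc q + Suc i) else xs ! i))"
    by (subst all_nat) simp
  show ?case
    unfolding jump_float_from.simps 2 nonneg step by auto
qed simp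

text \<open>The recursion caps an entry by its position only at the start of a run; since entries do
  not increase within a run, later positions inherit the cap.\<close>

lemma jump_float_iff: "jump_float n s \<longleftrightarrow> length s = n \<and> jump_float_from 1 1 s"
proof -
  have bounds: "(\<forall>i\<in>{1..n}. 0 \<le> entry s i \<and> entry s i \<le> int i) \<longleftrightarrow>
      (\<forall>i<n. 0 \<le> s ! i \<and> s ! i \<le> int (Suc i))"
    unfolding image_Suc_lessThan[symmetric] ball_simps by (simp add: entry_def Ball_def)
  have "{2..n} = Suc ` Suc ` {i. Suc i < n}"
    by (auto simp: image_iff) presburger
  then have jumps: "(\<forall>i\<in>{2..n}. entry s i > entry s (i - 1) \<longrightarrow> entry s (i - 1) = 0) \<longleftrightarrow>
      (\<forall>i. Suc i < n \<longrightarrow> s ! Suc i > s ! i \<longrightarrow> s ! i = 0)"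
    by (simp add: entry_def)
  show ?thesis
  proof (cases "length s = n")
    case n: True
    show ?thesis
    proof
      assume "jump_float n s"
      then show "length s = n \<and> jump_float_from 1 1 s"
        unfolding jump_float_def bounds jumps jump_float_from_iff by fastforce
    next
      assume *: "length s = n \<and> jump_float_from 1 1 s"
      then have step: "s ! Suc i \<le> (if s ! i = 0 then int (1 + Suc i) else s ! i)"
        if "Suc i < n" for i
        using that unfolding jump_float_from_iff by blast
      have "s ! i \<le> int (Suc i)" if "i < n" for i
        using that
      proof (induction i)
        case 0
        then show ?case using * by (auto simp: jump_float_from_iff)
      next
        case (Suc i)
        then show ?case using step[of i] by (auto split: if_splits)
      qed
      moreover have "s ! i = 0" if "Suc i < n" "s ! Suc i > s ! i" for i
        using step[of i] that by (auto split: if_splits)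
      ultimately show "jump_float n s"
        unfolding jump_float_def bounds jumps using * by (auto simp: jump_float_from_iff)
    qed
  qed (simp add: jump_float_def)
qed

section \<open>Maximum weight as optimization over width lists\<close>

lemma weight_eq_sum_list: "weight s = sum_list s"
  unfolding weight_def entry_def sum_list_sum_nth atLeast0LessThan
  by (rule sum.reindex_bij_witness[of _ Suc "\<lambda>i. i - 1"]) auto

text \<open>Fixing \<open>sum_list (map Suc a)\<close> fixes the length: each run is counted
  together with the zero before it, the fictitious one included.\<close>

definition optimal_widths :: "nat list \<Rightarrow> bool" where
  "optimal_widths a \<longleftrightarrow> a \<noteq> [] \<and>
     (\<forall>b. b \<noteq> [] \<longrightarrow> sum_list (map Suc b) = sum_list (map Suc a) \<longrightarrow>
       layout_weight 1 b \<le> layout_weight 1 a)"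

lemma optimal_widthsD:
  assumes "optimal_widths a" "b \<noteq> []" "sum_list (map Suc b) = sum_list (map Suc a)"
  shows "layout_weight 1 b \<le> layout_weight 1 a"
  using assms unfolding optimal_widths_def by blast

text \<open>Every competing width list is realized by its layout without the leading zero, so a
  maximum attains the \<open>layout_weight\<close> bound and the equality case determines
  \<open>s\<close>.\<close>

lemma max_jump_float_is_layout:
  assumes "s \<in> max_jump_floats n"
  shows "optimal_widths (widths s)" "0 # s = layout 0 (widths s)"
proof -
  have s: "length s = n" "jump_float_from 1 1 s"
    and max: "\<And>t. jump_float n t \<Longrightarrow> sum_list t \<le> sum_list s"
    using assms by (auto simp: max_jump_floats_def jump_float_iff weight_eq_sum_list)
  obtain w ws where w: "widths s = w # ws"
    by (cases "widths s") auto
  have le: "sum_list s \<le> layout_weight 1 (widths s)"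
    using sum_list_le_layout_weight(1)[OF s(2) w] w by (simp add: algebra_simps)
  have layout_le: "layout_weight 1 b \<le> sum_list s"
    if b: "b \<noteq> []" "sum_list (map Suc b) = sum_list (map Suc (widths s))" for b
  proof -
    define t where "t = tl (layout 0 b)"
    have t: "layout 0 b = 0 # t"
      using layout_eq_Cons[OF b(1)] by (simp add: t_def)
    have "length t = n"
      using length_layout[of 0 b] b s t sum_list_Suc_widths[of s] by simp
    moreover have "jump_float_from 1 1 t"
      using jump_float_from_layout[of 0 0 b] t by simp
    ultimately have "sum_list t \<le> sum_list s"
      by (intro max) (auto simp: jump_float_iff)
    then show ?thesis
      using sum_list_layout[of 0 b] t by simp
  qed
  show "optimal_widths (widths s)"
    unfolding optimal_widths_def using le layout_le by force
  have "sum_list s = layout_weight 1 (widths s)"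
    using le layout_le[of "widths s"] by simp
  then show "0 # s = layout 0 (widths s)"
    using sum_list_le_layout_weight(2)[OF s(2) w] w by (simp add: algebra_simps)
qed

section \<open>Exchange moves on optimal width lists\<close>

lemma sum_list_map_Suc_update:
  assumes "i < length a"
  shows "sum_list (map Suc (a[i := w])) + a ! i = sum_list (map Suc a) + w"
  using assms by (induction a arbitrary: i) (auto split: nat.splits)

text \<open>Runs up to \<open>i\<close> start one position later, the others stay in place. The gain
  of one per cell before run \<open>i\<close> cancels against the same cells counted in the start of
  run \<open>i\<close>; of that start only \<open>p\<close> and \<open>i\<close> separating zeros
  remain.\<close>

lemma layout_weight_shift:
  assumes "i < length a" "a ! i = Suc w"
  shows "layout_weight (Suc p) (a[i := w]) = layout_weight p a + int (a ! i) - int (p + i + 1)"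
  using assms
proof (induction a arbitrary: i p)
  case (Cons x xs)
  then show ?case
    by (cases i) (use Cons.IH[of "i - 1" "p + x + 1"] in \<open>auto simp: algebra_simps\<close>)
qed simp

lemma layout_weight_shift':
  assumes "i < length a"
  shows "layout_weight p (a[i := Suc (a ! i)]) =
         layout_weight (Suc p) a - int (a ! i) + int (p + i)"
  using layout_weight_shift[of i "a[i := Suc (a ! i)]" "a ! i" p] assms by simp

context
  fixes a :: "nat list"
  assumes opt: "optimal_widths a"
begin

lemma optimal_width_le:
  assumes i: "i < length a"
  shows "a ! i \<le> i + 2"
proof (cases "a ! i")
  case (Suc w)
  \<comment> \<open>The prepended empty run makes up for the removed cell; with indices from 0 the
    change is \<open>a ! i - i - 2\<close>.\<close>
  have "layout_weight 1 (0 # a[i := w]) \<le> layout_weight 1 a"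
    using sum_list_map_Suc_update[OF i, of w] Suc by (intro optimal_widthsD[OF opt]) auto
  then show ?thesis
    using layout_weight_shift[OF i Suc, of 1] by simp
qed simp

lemma optimal_width_move:
  assumes i: "i < length a" and j: "j < length a" "a ! j > 0"
  shows "a ! j + i \<le> a ! i + j + 1"
proof (cases "i = j")
  case False
  obtain w where w: "a ! j = Suc w"
    using j by (cases "a ! j") auto
  \<comment> \<open>A cell moves from run \<open>j\<close> to run \<open>i\<close>. Weighing the
    intermediate list from position 2 composes the two shifts without an extra run.\<close>
  let ?b = "a[j := w]"
  have "sum_list (map Suc (?b[i := Suc (?b ! i)])) = sum_list (map Suc a)"
    using sum_list_map_Suc_update[OF j(1), of w] sum_list_map_Suc_update[of i ?b "Suc (?b ! i)"] i w
    by simp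
  then have "layout_weight 1 (?b[i := Suc (?b ! i)]) \<le> layout_weight 1 a"
    using i by (intro optimal_widthsD[OF opt]) auto
  then show ?thesis
    using layout_weight_shift'[of i ?b 1] layout_weight_shift[OF j(1) w, of 1] i False by simp
qed simp

text \<open>An empty first run can be deleted in favor of a new cell in run \<open>i\<close>. If the
  first run is nonempty, one of its cells moves to run \<open>i\<close> instead.\<close>

lemma optimal_width_ge:
  assumes i: "i < length a"
  shows "i \<le> a ! i"
proof (cases i)
  case (Suc k)
  then obtain x b where a: "a = x # b" and b: "k < length b"
    using i by (cases a) auto
  show ?thesis
  proof (cases "x = 0")
    case True
    have "sum_list (map Suc (b[k := Suc (b ! k)])) = sum_list (map Suc a)"
      using sum_list_map_Suc_update[OF b, of "Suc (b ! k)"] a True by simp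
    then have "layout_weight 1 (b[k := Suc (b ! k)]) \<le> layout_weight 1 a"
      using b by (intro optimal_widthsD[OF opt]) auto
    then show ?thesis
      using layout_weight_shift'[OF b, of 1] a True Suc by simp
  next
    case False
    then show ?thesis
      using optimal_width_move[of i 0] i a by auto
  qed
qed simp

text \<open>If run \<open>j\<close> is empty, there is no cell to move and the lower bound on
  \<open>a ! i\<close> suffices.\<close>

lemma optimal_width_balanced:
  assumes "i < length a" "j < length a"
  shows "a ! j + i \<le> a ! i + j + 1"
  using optimal_width_move[OF assms] optimal_width_ge[OF assms(1)] by (cases "a ! j = 0") auto

end

section \<open>Reading the block sequence off a layout\<close>

lemma filter_unique:
  assumes "distinct xs" "x \<in> set xs" "\<And>y. y \<in> set xs \<Longrightarrow> P y \<longleftrightarrow> y = x"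
  shows "filter P xs = [x]"
proof -
  have "filter P xs = filter (\<lambda>y. y = x) xs"
    using assms(3) by (rule filter_cong[OF refl])
  also have "\<dots> = [x]"
    using assms(1,2) by (induction xs) (auto simp: filter_empty_conv)
  finally show ?thesis .
qed

lemma block_end_unique:
  assumes "is_block s i j" "is_block s i k"
  shows "j = k"
proof -
  have False if "is_block s i j" "is_block s i k" "j < k" for j k
    using that unfolding is_block_def by (auto dest: bspec[of _ _ "j + 1"])
  then show ?thesis
    using assms by (metis linorder_neqE_nat)
qed

definition blocks_at :: "int list \<Rightarrow> nat \<Rightarrow> nat list" where
  "blocks_at s i = [j - i + 1. j \<leftarrow> [1..<length s + 1], is_block s i j]"

lemma block_seq_eq: "block_seq s = concat (map (blocks_at s) [1..<length s + 1])"
  unfolding block_seq_def blocks_at_def ..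

lemma blocks_at_eq_Nil: "(\<And>j. \<not> is_block s i j) \<Longrightarrow> blocks_at s i = []"
  by (simp add: blocks_at_def)

lemma blocks_at_eq:
  assumes "is_block s i j"
  shows "blocks_at s i = [j - i + 1]"
proof -
  have "is_block s i k \<longleftrightarrow> k = j" for k
    using assms block_end_unique by blast
  moreover have "j \<in> set [1..<length s + 1]"
    using assms by (auto simp: is_block_def)
  ultimately have "filter (is_block s i) [1..<length s + 1] = [j]"
    by (intro filter_unique distinct_upt) auto
  moreover have "concat (map (\<lambda>j. if is_block s i j then [j - i + 1] else []) xs) =
      map (\<lambda>j. j - i + 1) (filter (is_block s i) xs)" for xs
    by (induction xs) auto
  ultimately show ?thesis
    by (simp add: blocks_at_def)
qed

text \<open>Entry \<open>k \<ge> 1\<close> of \<open>s\<close> is the element with index \<open>k\<close> of \<open>0 # s\<close>.\<close>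

lemma blocks_of_layout:
  assumes "drop q (0 # s) = layout q ws" "0 \<notin> set ws" "q \<le> length s"
  shows "concat (map (blocks_at s) [q + 1..<length s + 1]) = ws"
  using assms
proof (induction ws arbitrary: q)
  case Nil
  then show ?case by simp
next
  case (Cons w ws)
  let ?r = "q + w + 1"
  have w: "w > 0"
    using Cons.prems by (cases w) auto
  have entry: "entry s (q + k) = layout q (w # ws) ! k" if "k > 0" "q + k \<le> length s" for k
  proof -
    have "entry s (q + k) = (0 # s) ! (q + k)"
      using that by (simp add: entry_def nth_Cons')
    also have "\<dots> = drop q (0 # s) ! k"
      using that by (intro nth_drop[symmetric]) simp
    finally show ?thesis
      using Cons.prems by simp
  qed
  have len: "Suc (length s) = ?r + length (layout ?r ws)"
    using arg_cong[OF Cons.prems(1), of length] Cons.prems(3) by simp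
  have run: "entry s k = int q + 1" if "k \<in> {q + 1..q + w}" for k
    using entry[of "k - q"] that len by (auto simp: nth_append nth_Cons')
  have zero: "entry s ?r = 0" if ws: "ws \<noteq> []"
  proof -
    obtain v vs where "ws = v # vs"
      using ws by (cases ws) auto
    then show ?thesis
      using entry[of "w + 1"] len by (simp add: nth_append)
  qed
  \<comment> \<open>For \<open>q = 0\<close> the fictitious zero stands in for the left
    neighbor.\<close>
  have before: "q = 0 \<or> entry s q = 0"
  proof (cases q)
    case (Suc p)
    have "drop q (0 # s) ! 0 = 0"
      using Cons.prems(1) by simp
    then show ?thesis
      using Suc Cons.prems(3) by (simp add: entry_def)
  qed simp
  have "is_block s (q + 1) (q + w)"
    unfolding is_block_def using run w len before zero by (cases ws) auto
  then have first: "blocks_at s (q + 1) = [w]"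
    using w by (simp add: blocks_at_eq)
  \<comment> \<open>Later cells of the run have a nonzero left neighbor, so no block starts
    there.\<close>
  have rest: "concat (map (blocks_at s) [q + 2..<?r]) = []"
  proof -
    have "blocks_at s k = []" if k: "k \<in> {q + 2..<?r}" for k
    proof -
      have "entry s (k - 1) = int q + 1"
        using k by (intro run) auto
      then show ?thesis
        using k by (intro blocks_at_eq_Nil) (auto simp: is_block_def)
    qed
    then show ?thesis by auto
  qed
  have split: "[q + 1..<length s + 1] = (q + 1) # [q + 2..<?r] @ [?r..<length s + 1]"
    using w len upt_add_eq_append[of "q + 1" ?r "length (layout ?r ws)"]
      upt_conv_Cons[of "q + 1" ?r]
    by (simp del: upt_Suc)
  have "concat (map (blocks_at s) [?r..<length s + 1]) = ws"
  proof (cases "ws = []")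
    case True
    then show ?thesis using len by simp
  next
    case False
    have r: "?r \<le> length s"
      using False len by (cases ws) auto
    have "drop ?r (0 # s) = drop (w + 1) (drop q (0 # s))"
      by (simp add: add.commute)
    also have "\<dots> = layout ?r ws"
      unfolding Cons.prems(1) by simp
    finally have "concat (map (blocks_at s) [?r + 1..<length s + 1]) = ws"
      using Cons.prems r by (intro Cons.IH) auto
    moreover have "blocks_at s ?r = []"
      using zero[OF False] r by (intro blocks_at_eq_Nil) (auto simp: is_block_def)
    moreover have "[?r..<length s + 1] = ?r # [?r + 1..<length s + 1]"
      using r by (simp add: upt_conv_Cons del: upt_Suc)
    ultimately show ?thesis by simp
  qed
  then show ?case
    unfolding split using first rest by simp
qed

text \<open>Only the first width may be zero, and then \<open>s\<close> begins with a zero: the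
  \<open>0\<close> that \<open>ext_block_seq\<close> prepends records exactly this empty first
  run.\<close>

lemma ext_block_seq_layout:
  assumes s: "0 # s = layout 0 a" "s \<noteq> []" and a: "0 \<notin> set (tl a)"
  shows "ext_block_seq s = a"
proof -
  obtain w ws where w: "a = w # ws"
    using s by (cases a) auto
  show ?thesis
  proof (cases "w = 0")
    case False
    have "block_seq s = a"
      using blocks_of_layout[of 0 s a] s a w False by (simp add: block_seq_eq)
    moreover have "entry s 1 \<noteq> 0"
      using s(1) w False by (cases w) (auto simp: entry_def)
    ultimately show ?thesis
      by (simp add: ext_block_seq_def)
  next
    case True
    then have s1: "s = layout 1 ws"
      using s w by simp
    then have e: "entry s 1 = 0"
      using s(2) by (cases ws) (auto simp: entry_def)
    have "concat (map (blocks_at s) [1 + 1..<length s + 1]) = ws"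
      using s1 s(2) a w by (intro blocks_of_layout) (auto simp: Suc_le_eq)
    moreover have "blocks_at s 1 = []"
      using e by (intro blocks_at_eq_Nil) (auto simp: is_block_def)
    moreover have "[1..<length s + 1] = 1 # [1 + 1..<length s + 1]"
      using s(2) by (simp add: upt_conv_Cons del: upt_Suc)
    ultimately have "block_seq s = ws"
      by (simp add: block_seq_eq del: upt_Suc)
    then show ?thesis
      using e True w by (simp add: ext_block_seq_def)
  qed
qed

section \<open>Counting cells with triangular numbers\<close>

lemma sum_Suc_eq_tri: "(\<Sum>i<k. Suc i) = tri k"
  by (induction k) (auto simp: tri_Suc, simp add: tri_def)

text \<open>As \<open>l \<le> \<rho> + 1\<close>, the value \<open>tri (\<rho> + 1) + l\<close>
  stays below \<open>tri (\<rho> + 2)\<close>.\<close>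

lemma tri_decomposition_unique:
  assumes "l \<le> \<rho> + 1" "l' \<le> \<rho>' + 1" "tri (\<rho> + 1) + l = tri (\<rho>' + 1) + l'"
  shows "\<rho> = \<rho>'" "l = l'"
proof -
  have "\<not> \<rho> < \<rho>'" if "l \<le> \<rho> + 1" "tri (\<rho> + 1) + l = tri (\<rho>' + 1) + l'" for \<rho> \<rho>' l l'
    using that tri_mono[of "\<rho> + 2" "\<rho>' + 1"] by (auto simp: tri_Suc)
  then show "\<rho> = \<rho>'"
    using assms by (metis linorder_neqE_nat)
  then show "l = l'"
    using assms(3) by simp
qed

lemma list_eq_map_upt_Suc:
  assumes "\<And>i. i < length a \<Longrightarrow> a ! i = f (Suc i)"
  shows "a = map f [1..<length a + 1]"
  using assms by (intro nth_equalityI) (auto simp del: upt_Suc)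

text \<open>Serves both forms: with 0-based \<open>i\<close>, the base width \<open>c i\<close> is
  \<open>Suc i\<close> for form A and \<open>i\<close> for form B.\<close>

lemma sum_list_eq_sum_plus_card:
  fixes a :: "nat list"
  assumes a: "\<And>i. i < length a \<Longrightarrow> a ! i = (if Suc i \<in> X then Suc (c i) else c i)"
    and X: "X \<subseteq> {1..length a}"
  shows "sum_list a = (\<Sum>i<length a. c i) + card X"
proof -
  have "sum_list a = (\<Sum>i<length a. c i + (if Suc i \<in> X then 1 else 0))"
    unfolding sum_list_sum_nth atLeast0LessThan using a by (intro sum.cong) auto
  also have "\<dots> = (\<Sum>i<length a. c i) + card {i \<in> {..<length a}. Suc i \<in> X}"
    by (simp add: sum.distrib sum.If_cases Int_def)
  also have "card {i \<in> {..<length a}. Suc i \<in> X} = card X"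
  proof (rule bij_betw_same_card)
    show "bij_betw Suc {i \<in> {..<length a}. Suc i \<in> X} X"
      using X by (intro bij_betw_byWitness[of _ "\<lambda>j. j - 1"]) (auto, force)
  qed
  finally show ?thesis .
qed

theorem theorem4p3:
  fixes n \<rho> l :: nat and s :: "int list"
  assumes "n \<ge> 1"
    and "\<rho> \<ge> 1" and "0 \<le> l" and "l \<le> \<rho> + 1"
    and "int n = int (tri (\<rho> + 1)) - 2 + int l"
    and "s \<in> max_jump_floats n"
  shows "(\<exists>X \<in> subsets_of_size \<rho> (int l).
            ext_block_seq s = map (\<lambda>j. if j \<in> X then j + 1 else j) [1..<\<rho> + 1])
       \<or> (\<exists>X \<in> subsets_of_size (\<rho> + 1) (int l - 1).
            ext_block_seq s = map (\<lambda>j. if j \<in> X then j else j - 1) [1..<\<rho> + 2])"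
proof -
  define a where "a = widths s"
  define k where "k = length a"
  have opt: "optimal_widths a" and s: "0 # s = layout 0 a"
    using max_jump_float_is_layout[OF assms(6)] by (auto simp: a_def)
  have len: "length s = n"
    using assms(6) by (auto simp: max_jump_floats_def jump_float_def)
  have k: "k > 0"
    by (simp add: a_def k_def)
  have total: "sum_list a + k = n + 1"
    using sum_list_Suc_widths[of s] len by (simp add: a_def k_def sum_list_Suc)
  have n: "n + 2 = tri (\<rho> + 1) + l"
    using assms(5) by linarith
  note le = optimal_width_le[OF opt] and ge = optimal_width_ge[OF opt]
    and balanced = optimal_width_balanced[OF opt]
  have "0 \<notin> set (tl a)"
  proof
    assume "0 \<in> set (tl a)"
    then obtain i where "i < length (tl a)" "tl a ! i = 0"
      by (auto simp: in_set_conv_nth)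
    then have "Suc i < length a" "a ! Suc i = 0"
      by (auto simp: nth_tl)
    then show False
      using ge[of "Suc i"] by simp
  qed
  then have ext: "ext_block_seq s = a"
    using s len assms(1) by (intro ext_block_seq_layout) auto
  show ?thesis
  \<comment> \<open>Form A arises when no run falls short of its 1-based index, form B
    otherwise.\<close>
  proof (cases "\<forall>i<k. Suc i \<le> a ! i")
    case True
    define X where "X = {j \<in> {1..k}. a ! (j - 1) = j + 1}"
    have nth: "a ! i = (if Suc i \<in> X then Suc (Suc i) else Suc i)" if "i < length a" for i
      using True le[OF that] that by (auto simp: X_def k_def le_Suc_eq)
    have X: "X \<subseteq> {1..k}"
      by (auto simp: X_def)
    then have card: "card X \<le> k"
      using card_mono[of "{1..k}" X] by simp
    have "sum_list a = tri k + card X"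
      using sum_list_eq_sum_plus_card[of a X Suc] nth X by (simp add: k_def sum_Suc_eq_tri)
    then have "tri (\<rho> + 1) + l = tri (k + 1) + card X"
      using total n by (simp add: tri_Suc)
    then have "\<rho> = k" "l = card X"
      using tri_decomposition_unique[of l \<rho> "card X" k] assms(4) card by auto
    moreover have "a = map (\<lambda>j. if j \<in> X then j + 1 else j) [1..<k + 1]"
      unfolding k_def using nth by (intro list_eq_map_upt_Suc) simp
    ultimately show ?thesis
      unfolding ext subsets_of_size_def using X by blast
  next
    case False
    then obtain m where m: "m < k" "a ! m \<le> m"
      by (auto simp: not_le less_Suc_eq_le)
    define X where "X = {j \<in> {1..k}. a ! (j - 1) = j}"
    \<comment> \<open>Balancing run \<open>i\<close> against the short run \<open>m\<close> gives
      \<open>a ! i \<le> i + 1\<close>.\<close>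
    have nth: "a ! i = (if Suc i \<in> X then Suc i else i)" if "i < length a" for i
      using m ge[OF that] balanced[of m i] that by (auto simp: X_def k_def le_Suc_eq)
    have X: "X \<subseteq> {1..k}"
      by (auto simp: X_def)
    \<comment> \<open>The short run keeps \<open>card X + 1\<close> within \<open>r + 1\<close>, as
      uniqueness of the decomposition requires.\<close>
    moreover have "Suc m \<notin> X"
      using m by (auto simp: X_def)
    ultimately have "X \<subset> {1..k}"
      using m by auto
    then have card: "card X < k"
      using psubset_card_mono[of "{1..k}" X] by simp
    obtain r where r: "k = Suc r"
      using k by (cases k) auto
    have "(\<Sum>i<k. i) = tri r"
      unfolding r by (simp add: sum.lessThan_Suc_shift sum_Suc_eq_tri del: sum.lessThan_Suc)
    then have "sum_list a = tri r + card X"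
      using sum_list_eq_sum_plus_card[of a X "\<lambda>i. i"] nth X by (simp add: k_def)
    then have "tri (\<rho> + 1) + l = tri (r + 1) + (card X + 1)"
      using total n r by (simp add: tri_Suc)
    then have "\<rho> = r" "l = card X + 1"
      using tri_decomposition_unique[of l \<rho> "card X + 1" r] assms(4) card r by auto
    moreover have "a = map (\<lambda>j. if j \<in> X then j else j - 1) [1..<k + 1]"
      unfolding k_def using nth by (intro list_eq_map_upt_Suc) simp
    ultimately show ?thesis
      unfolding ext subsets_of_size_def using X r by (intro disjI2 bexI[of _ X]) auto
  qed
qed

end
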